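(* Let $d\ge 1$ and $k\ge2$ be integers, and let $T_d$ denote the $(d+1)$-regular infinite tree. If $T$ is an infinite tree with maximum degree $d+1$, then $p(T,k)\ge q(T_d,k)>0$.
   Context: Bootstrap percolation with the $k$-neighbor rule ($k$-rule) on a countable, connected, locally finite graph $G=(V,E)$: initially each vertex is occupied with probability $p$ and vacant with probability $1-p$, independently of each other (law $\mathbb{P}_p$). Then a deterministic rule is iterated in discrete time: if a vacant vertex has at least $k$ occupied neighbors at some time step, it becomes occupied in the next step; occupied vertices remain occupied. The final configuration is the limiting one (a vertex is occupied in it if it is occupied at some time). Complete occupation is the event that every vertex is occupied in the final configuration. For an infinite graph $G$, $p(G,k)=\inf\{p\in[0,1] : \mathbb{P}_p(\text{complete occupation})>0\}$, and $q(G,k)$ is the infimum of the $p\in[0,1]$ for which, with positive $\mathbb{P}_p$-probability, there is an infinite connected component of occupied vertices in the final configuration. *)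

theory Defs
  imports "HOL-Probability.Probability" "Graph_Theory.Graph_Theory"
begin

text \<open>
  A simple graph is a symmetric loop-free pair digraph, so an undirected edge is a pair of
  opposite arcs and the out-degree of a vertex is its degree. Degrees are cardinalities, hence
  \<open>0\<close> for infinite sets, which is why local finiteness is a separate assumption.
\<close>

locale percolation_graph = pair_bidirected_digraph G for G :: "'a pair_pre_digraph" +
  assumes countable_verts: "countable (pverts G)"
    and connected_graph: "Digraph_Component.connected (with_proj G)"
    and locally_finite: "v \<in> pverts G \<Longrightarrow> finite (out_arcs (with_proj G) v)"

text \<open>
  The library constant \<open>tree\<close> is not usable here: in a symmetric digraph every edge
  traversed back and forth is a directed cycle of length 2. Cycles of the undirected graph are
  the directed cycles of length at least 3.
\<close>

locale infinite_tree = percolation_graph G for G :: "'a pair_pre_digraph" +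
  assumes no_cycles: "\<not> (\<exists>c. pre_digraph.cycle (with_proj G) c \<and> 3 \<le> length c)"
    and infinite_verts: "infinite (pverts G)"

definition has_max_degree :: "'a pair_pre_digraph \<Rightarrow> nat \<Rightarrow> bool" where
  "has_max_degree G D \<longleftrightarrow>
     (\<forall>v \<in> pverts G. out_degree (with_proj G) v \<le> D) \<and>
     (\<exists>v \<in> pverts G. out_degree (with_proj G) v = D)"

definition regular_graph :: "'a pair_pre_digraph \<Rightarrow> nat \<Rightarrow> bool" where
  "regular_graph G D \<longleftrightarrow> (\<forall>v \<in> pverts G. out_degree (with_proj G) v = D)"

text \<open>Configurations are represented by their sets of occupied vertices.\<close>

definition bootstrap_step :: "'a pair_pre_digraph \<Rightarrow> nat \<Rightarrow> 'a set \<Rightarrow> 'a set" where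
  "bootstrap_step G k A =
     A \<union> {v \<in> pverts G. k \<le> card {w. (v, w) \<in> parcs G \<and> w \<in> A}}"

definition final_config :: "'a pair_pre_digraph \<Rightarrow> nat \<Rightarrow> 'a set \<Rightarrow> 'a set" where
  "final_config G k A = (\<Union>t. (bootstrap_step G k ^^ t) A)"

definition initial_law :: "'a pair_pre_digraph \<Rightarrow> real \<Rightarrow> ('a \<Rightarrow> bool) measure" where
  "initial_law G p = PiM (pverts G) (\<lambda>_. measure_pmf (bernoulli_pmf p))"

definition occupied :: "'a pair_pre_digraph \<Rightarrow> ('a \<Rightarrow> bool) \<Rightarrow> 'a set" where
  "occupied G \<omega> = {v \<in> pverts G. \<omega> v}"

text \<open>
  The strongly connected components of the (symmetric) subgraph induced by \<open>A\<close> are its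
  connected components.
\<close>

definition has_infinite_component :: "'a pair_pre_digraph \<Rightarrow> 'a set \<Rightarrow> bool" where
  "has_infinite_component G A \<longleftrightarrow>
     (\<exists>C \<in> pre_digraph.sccs_verts (with_proj G \<restriction> A). infinite C)"

definition complete_occupation :: "'a pair_pre_digraph \<Rightarrow> nat \<Rightarrow> real \<Rightarrow> ('a \<Rightarrow> bool) set" where
  "complete_occupation G k p =
     {\<omega> \<in> space (initial_law G p). final_config G k (occupied G \<omega>) = pverts G}"

definition percolation_event :: "'a pair_pre_digraph \<Rightarrow> nat \<Rightarrow> real \<Rightarrow> ('a \<Rightarrow> bool) set" where
  "percolation_event G k p =
     {\<omega> \<in> space (initial_law G p).
        has_infinite_component G (final_config G k (occupied G \<omega>))}"

definition p_crit :: "'a pair_pre_digraph \<Rightarrow> nat \<Rightarrow> real" where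
  "p_crit G k = Inf {p \<in> {0..1}. measure (initial_law G p) (complete_occupation G k p) > 0}"

definition q_crit :: "'a pair_pre_digraph \<Rightarrow> nat \<Rightarrow> real" where
  "q_crit G k = Inf {p \<in> {0..1}. measure (initial_law G p) (percolation_event G k p) > 0}"

end

theory Submission
  imports Defs
begin

text \<open>
  For the comparison, note that a tree of maximum degree \<open>d + 1\<close> embeds into the
  \<open>(d + 1)\<close>-regular tree (\<open>tree_embedding\<close>). Restrict a random
  configuration on the regular tree to the embedded copy: it has the law of the initial
  configuration on the smaller tree, and the infection in the large tree dominates the one in the
  copy. So if the copy is filled with positive probability, the regular tree contains an infinite
  occupied component with at least that probability
  (\<open>complete_occupation_imp_percolation\<close>), and the inequality between the critical
  values follows by comparing infima.

  For positivity, note that tracing the infection of a vertex back in time gives a finite connected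
  set in which each vertex is initially occupied or has \<open>k \<ge> 2\<close> neighbors, in the
  set, that were infected earlier. Inside an infinite component of the final configuration, such
  sets containing a given vertex exist in arbitrarily large sizes
  (\<open>large_supporting_set\<close>). A forest has fewer edges than vertices, while each vertex
  that is not initially occupied accounts for at least two edges of its own, so at least half of the
  set must be initially occupied (\<open>self_supporting_half_initial\<close>). A connected set of
  \<open>m\<close> vertices is covered by a walk with \<open>2 * (m - 1)\<close> steps, so in a
  graph of maximum degree \<open>\<Delta>\<close> there are at most
  \<open>\<Delta> ^ (2 * (m - 1))\<close> of them at a given vertex, and the probability that one of
  them is at least half occupied is at most \<open>(2 * \<Delta>\<^sup>2 * sqrt p) ^ m\<close>. When
  \<open>2 * \<Delta>\<^sup>2 * sqrt p < 1\<close> this is summable, and Borel-Cantelli excludes an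
  infinite component almost surely (\<open>no_percolation_at_small_density\<close>).
\<close>

section \<open>Neighborhoods and components\<close>

definition neighbors :: "'a pair_pre_digraph \<Rightarrow> 'a \<Rightarrow> 'a set" where
  "neighbors G v = {w. (v, w) \<in> parcs G}"

lemma out_degree_eq_card_neighbors: "out_degree (with_proj G) v = card (neighbors G v)"
proof -
  have "out_arcs (with_proj G) v = Pair v ` neighbors G v"
    by (auto simp: out_arcs_def neighbors_def)
  then show ?thesis
    by (simp add: out_degree_def card_image inj_on_def)
qed

abbreviation edges_in :: "'a pair_pre_digraph \<Rightarrow> 'a set \<Rightarrow> 'a rel" where
  "edges_in G A \<equiv> parcs G \<inter> A \<times> A"

context percolation_graph
begin

lemma sym_edges: "(x, y) \<in> parcs G \<Longrightarrow> (y, x) \<in> parcs G"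
  by (rule arcs_symmetric)

lemma neighbors_subset: "neighbors G v \<subseteq> pverts G"
  using in_arcsD2 by (auto simp: neighbors_def)

lemma finite_neighbors: "finite (neighbors G v)"
proof (cases "v \<in> pverts G")
  case True
  have "neighbors G v = snd ` out_arcs (with_proj G) v"
    by (force simp: out_arcs_def neighbors_def)
  then show ?thesis using locally_finite[OF True] by simp
next
  case False
  then have "neighbors G v = {}" using in_arcsD1 by (auto simp: neighbors_def)
  then show ?thesis by simp
qed

lemma sym_edges_in_rtrancl:
  assumes "(x, y) \<in> (edges_in G A)\<^sup>*"
  shows "(y, x) \<in> (edges_in G A)\<^sup>*"
proof -
  have "sym (edges_in G A)" using sym_edges by (auto simp: sym_def)
  then show ?thesis using assms sym_rtrancl by (metis symD)
qed

lemma reachable_induce_iff: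
  assumes "v \<in> A"
  shows "v \<rightarrow>\<^sup>*\<^bsub>with_proj G \<restriction> A\<^esub> w \<longleftrightarrow> (v, w) \<in> (edges_in G A)\<^sup>*"
proof -
  interpret H: wf_digraph "with_proj G \<restriction> A"
    by unfold_locales auto
  have "arcs_ends (with_proj G \<restriction> A) = edges_in G A"
    by (auto simp: arcs_ends_def arc_to_ends_def)
  then show ?thesis using H.reachable_conv'[of v w] assms by simp
qed

lemma all_reachable:
  assumes "x \<in> pverts G" "y \<in> pverts G"
  shows "(x, y) \<in> (parcs G)\<^sup>*"
proof -
  have "x \<rightarrow>\<^sup>*\<^bsub>mk_symmetric (with_proj G)\<^esub> y"
    using connected_graph assms
    by (auto simp: Digraph_Component.connected_def strongly_connected_def mk_symmetric_def)
  then have "x \<rightarrow>\<^sup>*\<^bsub>with_proj G\<^esub> y"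
    using reachable_mk_symmetric_eq[OF sym_arcs] by simp
  then show ?thesis using reachable_rtranclI by fastforce
qed

text \<open>
  By symmetry the component of a vertex is just the set of vertices reachable from it. In this form
  the event becomes a countable combination of elementary ones.
\<close>

lemma has_infinite_component_iff:
  assumes "A \<subseteq> pverts G"
  shows "has_infinite_component G A \<longleftrightarrow> (\<exists>v\<in>A. infinite {w. (v, w) \<in> (edges_in G A)\<^sup>*})"
proof
  assume "has_infinite_component G A"
  then obtain C where C: "C \<in> pre_digraph.sccs_verts (with_proj G \<restriction> A)" "infinite C"
    by (auto simp: has_infinite_component_def)
  have reach: "u \<rightarrow>\<^sup>*\<^bsub>with_proj G \<restriction> A\<^esub> w" if "u \<in> C" "w \<in> C" for u w
    using C(1) that by (auto simp: pre_digraph.sccs_verts_def)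
  obtain v where v: "v \<in> C" using C(2) by fastforce
  have "v \<in> A" using reach[OF v v] by (auto elim: reachable_in_vertsE)
  moreover have "C \<subseteq> {w. (v, w) \<in> (edges_in G A)\<^sup>*}"
    using reach[OF v] reachable_induce_iff[OF \<open>v \<in> A\<close>] by auto
  ultimately show "\<exists>v\<in>A. infinite {w. (v, w) \<in> (edges_in G A)\<^sup>*}"
    using C(2) finite_subset by blast
next
  assume "\<exists>v\<in>A. infinite {w. (v, w) \<in> (edges_in G A)\<^sup>*}"
  then obtain v where v: "v \<in> A" and inf: "infinite {w. (v, w) \<in> (edges_in G A)\<^sup>*}"
    by auto
  let ?C = "{w. (v, w) \<in> (edges_in G A)\<^sup>*}"
  have inA: "w \<in> A" if "w \<in> ?C" for w
  proof -
    have "(v, w) \<in> (edges_in G A)\<^sup>*" using that by simp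
    then show ?thesis using v by induct auto
  qed
  have "?C \<in> pre_digraph.sccs_verts (with_proj G \<restriction> A)"
    unfolding pre_digraph.sccs_verts_def
  proof (intro CollectI conjI ballI allI impI)
    show "?C \<noteq> {}" by blast
  next
    fix u w assume "u \<in> ?C" "w \<in> ?C"
    then have "(u, w) \<in> (edges_in G A)\<^sup>*"
      using rtrancl_trans[OF sym_edges_in_rtrancl[of v u A], of w] by simp
    then show "u \<rightarrow>\<^sup>*\<^bsub>with_proj G \<restriction> A\<^esub> w"
      using reachable_induce_iff[OF inA[OF \<open>u \<in> ?C\<close>]] by simp
  next
    fix u w assume "u \<in> ?C" "w \<notin> ?C"
    then have "(u, w) \<notin> (edges_in G A)\<^sup>*" using rtrancl_trans[of v u _ w] by auto
    then show "\<not> u \<rightarrow>\<^sup>*\<^bsub>with_proj G \<restriction> A\<^esub> w \<or> \<not> w \<rightarrow>\<^sup>*\<^bsub>with_proj G \<restriction> A\<^esub> u"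
      using reachable_induce_iff[OF inA[OF \<open>u \<in> ?C\<close>]] by simp
  qed
  then show "has_infinite_component G A"
    using inf by (auto simp: has_infinite_component_def)
qed

end

context infinite_tree
begin

text \<open>
  The only use of acyclicity: a path from \<open>y\<close> to \<open>z\<close> that avoids
  \<open>x\<close> would close up to a cycle through \<open>x\<close>, of length at least 3 because
  \<open>y \<noteq> z\<close>.
\<close>

lemma neighbors_separated:
  assumes xy: "(x, y) \<in> parcs G" and xz: "(x, z) \<in> parcs G" and "y \<noteq> z"
  shows "(y, z) \<notin> (edges_in G (pverts G - {x}))\<^sup>*"
proof
  assume conn: "(y, z) \<in> (edges_in G (pverts G - {x}))\<^sup>*"
  let ?H = "with_proj G \<restriction> (pverts G - {x})"
  interpret H: wf_digraph ?H by unfold_locales auto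
  have "y \<in> pverts G - {x}" using xy in_arcsD2 no_loops' by fastforce
  then have "y \<rightarrow>\<^sup>*\<^bsub>?H\<^esub> z" using reachable_induce_iff[of y _ z] conn by simp
  then obtain p where p: "H.apath y p z"
    using H.reachable_awalk H.apath_awalk_to_apath by blast
  have vs: "H.awalk_verts y p = pawalk_verts y p"
    by (induct p arbitrary: y) (auto simp: pre_digraph.awalk_verts.simps)
  have cas: "H.cas y p z = pcas y p z"
    by (induct p arbitrary: y) (auto simp: pre_digraph.cas.simps)
  from p have aw: "H.awalk y p z" and dist: "distinct (pawalk_verts y p)"
    by (auto simp: H.apath_def vs)
  have notx: "x \<notin> set (pawalk_verts y p)" using aw vs by (auto elim!: H.awalkE)
  have awG: "awalk y p z"
    using aw by (auto simp: H.awalk_def awalk_def cas)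
  let ?c = "(x, y) # p @ [(z, x)]"
  have zx: "(z, x) \<in> parcs G" using xz by (rule sym_edges)
  have "awalk z [(z, x)] x" using zx in_arcsD2 by (auto simp: awalk_simps)
  then have aw': "awalk y (p @ [(z, x)]) x" by (rule awalk_appendI[OF awG])
  then have awc: "awalk x ?c x" using xy by (simp add: awalk_Cons_iff del: awalk_append_iff)
  have "pawalk_verts y (p @ [(z, x)]) = pawalk_verts y p @ [x]"
    using awalk_verts_append[OF aw'] by simp
  then have "distinct (tl (pawalk_verts x ?c))" using dist notx by simp
  then have "cycle ?c" using awc by (auto simp: cycle_def)
  moreover have "p \<noteq> []" using awG \<open>y \<noteq> z\<close> by (auto simp: awalk_Nil_iff)
  then have "3 \<le> length ?c" by (cases p) auto
  ultimately show False using no_cycles by blast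
qed

end

section \<open>Rooted trees and embeddings\<close>

definition depth :: "'a pair_pre_digraph \<Rightarrow> 'a \<Rightarrow> 'a \<Rightarrow> nat" where
  "depth G r x = (LEAST n. (r, x) \<in> parcs G ^^ n)"

text \<open>
  Choosing a root \<open>r\<close> orders the neighbors of a vertex: in a tree, exactly one neighbor
  of \<open>x \<noteq> r\<close> is nearer to \<open>r\<close> than \<open>x\<close>, and all the
  others are farther away.
\<close>

definition parent :: "'a pair_pre_digraph \<Rightarrow> 'a \<Rightarrow> 'a \<Rightarrow> 'a" where
  "parent G r x = (SOME y. (x, y) \<in> parcs G \<and> depth G r x = Suc (depth G r y))"

definition children :: "'a pair_pre_digraph \<Rightarrow> 'a \<Rightarrow> 'a \<Rightarrow> 'a set" where
  "children G r x = {y. (x, y) \<in> parcs G \<and> depth G r y = Suc (depth G r x)}"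

context percolation_graph
begin

lemma depth_root: "depth G r r = 0"
  by (simp add: depth_def)

lemma depth_attained:
  assumes "r \<in> pverts G" "x \<in> pverts G"
  shows "(r, x) \<in> parcs G ^^ depth G r x"
  using all_reachable[OF assms] unfolding depth_def rtrancl_power by (rule LeastI_ex)

lemma depth_le: "(r, x) \<in> parcs G ^^ n \<Longrightarrow> depth G r x \<le> n"
  unfolding depth_def by (rule Least_le)

lemma depth_eq_0_iff:
  assumes "r \<in> pverts G" "x \<in> pverts G"
  shows "depth G r x = 0 \<longleftrightarrow> x = r"
  using depth_attained[OF assms] depth_root[of r] by auto

lemma exists_nearer_neighbor:
  assumes r: "r \<in> pverts G" and x: "x \<in> pverts G" and "x \<noteq> r"
  shows "\<exists>y. (x, y) \<in> parcs G \<and> depth G r x = Suc (depth G r y)"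
proof -
  obtain n where n: "depth G r x = Suc n"
    using depth_eq_0_iff[OF r x] \<open>x \<noteq> r\<close> not0_implies_Suc by blast
  then have "(r, x) \<in> parcs G ^^ Suc n" using depth_attained[OF r x] by simp
  then obtain y where y: "(r, y) \<in> parcs G ^^ n" "(y, x) \<in> parcs G" by auto
  have "depth G r y \<le> n" using depth_le y(1) .
  moreover have "(r, x) \<in> parcs G ^^ Suc (depth G r y)"
    using depth_attained[OF r in_arcsD1[OF y(2)]] y(2) by auto
  then have "Suc n \<le> Suc (depth G r y)" using depth_le n by metis
  ultimately show ?thesis using n y(2) sym_edges by auto
qed

lemma
  assumes "r \<in> pverts G" and "x \<in> pverts G" and "x \<noteq> r"
  shows parent_edge: "(x, parent G r x) \<in> parcs G"
    and depth_parent: "depth G r x = Suc (depth G r (parent G r x))"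
  using someI_ex[OF exists_nearer_neighbor[OF assms]] unfolding parent_def by auto

text \<open>
  A shortest path from \<open>y\<close> to the root meets, after \<open>y\<close>, only vertices of
  smaller depth than \<open>y\<close>. So it cannot pass through another vertex that is at least as
  deep as \<open>y\<close>.
\<close>

lemma connected_to_root_avoiding:
  assumes r: "r \<in> pverts G" and x: "x \<in> pverts G"
  shows "y \<in> pverts G \<Longrightarrow> y \<noteq> x \<Longrightarrow> depth G r y \<le> depth G r x
    \<Longrightarrow> (y, r) \<in> (edges_in G (pverts G - {x}))\<^sup>*"
proof (induction "depth G r y" arbitrary: y)
  case 0
  then show ?case using depth_eq_0_iff[OF r] by auto
next
  case (Suc n)
  have "y \<noteq> r" using Suc.hyps(2) depth_root by auto
  let ?z = "parent G r y"
  have z: "(y, ?z) \<in> parcs G" "n = depth G r ?z" "?z \<in> pverts G"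
    using parent_edge[OF r Suc.prems(1) \<open>y \<noteq> r\<close>] depth_parent[OF r Suc.prems(1) \<open>y \<noteq> r\<close>]
      Suc.hyps(2) in_arcsD2 by auto
  have lt: "depth G r ?z < depth G r x" using Suc z by simp
  then have "(?z, r) \<in> (edges_in G (pverts G - {x}))\<^sup>*"
    using Suc.hyps(1)[OF z(2,3)] by auto
  moreover have "(y, ?z) \<in> edges_in G (pverts G - {x})"
    using z Suc.prems lt by auto
  ultimately show ?case by (rule converse_rtrancl_into_rtrancl[rotated])
qed

end

context infinite_tree
begin

text \<open>
  Two distinct neighbors of \<open>x\<close> that are no deeper than \<open>x\<close> would be
  connected through the root without using \<open>x\<close>, against
  \<open>neighbors_separated\<close>. The inequalities are not strict, so adjacent vertices of equal
  depth are excluded too.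
\<close>

lemma nearer_neighbor_unique:
  assumes r: "r \<in> pverts G"
    and xy: "(x, y) \<in> parcs G" "depth G r y \<le> depth G r x"
    and xz: "(x, z) \<in> parcs G" "depth G r z \<le> depth G r x"
  shows "y = z"
proof (rule ccontr)
  assume "y \<noteq> z"
  have x: "x \<in> pverts G" using xy in_arcsD1 by blast
  have "(w, r) \<in> (edges_in G (pverts G - {x}))\<^sup>*"
    if "(x, w) \<in> parcs G" "depth G r w \<le> depth G r x" for w
    using connected_to_root_avoiding[OF r x _ _ that(2)] that(1) in_arcsD2 no_loops' by metis
  from this[OF xy] this[OF xz] have "(y, z) \<in> (edges_in G (pverts G - {x}))\<^sup>*"
    using sym_edges_in_rtrancl rtrancl_trans by metis
  then show False using neighbors_separated[OF xy(1) xz(1) \<open>y \<noteq> z\<close>] by contradiction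
qed

lemma edge_to_nearer_is_parent:
  assumes r: "r \<in> pverts G" and xy: "(x, y) \<in> parcs G" "depth G r y \<le> depth G r x"
  shows "x \<noteq> r \<and> y = parent G r x"
proof
  have V: "x \<in> pverts G" "y \<in> pverts G" using xy in_arcsD1 in_arcsD2 by auto
  show "x \<noteq> r"
    using depth_root[of r] depth_eq_0_iff[OF r V(2)] xy no_loops' by force
  then show "y = parent G r x"
    using nearer_neighbor_unique[OF r xy parent_edge[OF r V(1)]] depth_parent[OF r V(1)] by simp
qed

lemma edge_cases:
  assumes r: "r \<in> pverts G" and xy: "(x, y) \<in> parcs G"
  shows "x \<noteq> r \<and> y = parent G r x \<or> y \<noteq> r \<and> x = parent G r y"
  using edge_to_nearer_is_parent[OF r xy] edge_to_nearer_is_parent[OF r sym_edges[OF xy]]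
    le_cases by blast

lemma childD:
  assumes r: "r \<in> pverts G" and y: "y \<in> children G r x"
  shows "y \<in> pverts G" "y \<noteq> r" "parent G r y = x" "depth G r y = Suc (depth G r x)"
proof -
  have xy: "(x, y) \<in> parcs G" and d: "depth G r y = Suc (depth G r x)"
    using y by (auto simp: children_def)
  show "y \<in> pverts G" using xy in_arcsD2 by blast
  show "depth G r y = Suc (depth G r x)" by (rule d)
  show "y \<noteq> r" "parent G r y = x"
    using edge_to_nearer_is_parent[OF r sym_edges[OF xy]] d by auto
qed

lemma child_of_parent:
  assumes "r \<in> pverts G" "x \<in> pverts G" "x \<noteq> r"
  shows "x \<in> children G r (parent G r x)"
  using parent_edge[OF assms] depth_parent[OF assms] sym_edges by (auto simp: children_def)

lemma finite_children: "finite (children G r x)"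
  using finite_neighbors[of x] by (rule finite_subset[rotated]) (auto simp: children_def neighbors_def)

lemma card_children:
  assumes r: "r \<in> pverts G" and x: "x \<in> pverts G"
  shows "card (children G r x) = (if x = r then card (neighbors G x) else card (neighbors G x) - 1)"
proof (cases "x = r")
  case True
  have "children G r x = neighbors G x"
  proof
    show "neighbors G x \<subseteq> children G r x"
    proof
      fix y assume "y \<in> neighbors G x"
      then have xy: "(x, y) \<in> parcs G" by (simp add: neighbors_def)
      then have "y \<noteq> r \<and> x = parent G r y" using edge_cases[OF r xy] True by blast
      then show "y \<in> children G r x" using child_of_parent[OF r in_arcsD2[OF xy]] by auto
    qed
  qed (auto simp: children_def neighbors_def)
  then show ?thesis using True by simp
next
  case False
  have "neighbors G x = insert (parent G r x) (children G r x)"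
  proof
    show "neighbors G x \<subseteq> insert (parent G r x) (children G r x)"
    proof
      fix y assume "y \<in> neighbors G x"
      then have xy: "(x, y) \<in> parcs G" by (simp add: neighbors_def)
      then show "y \<in> insert (parent G r x) (children G r x)"
        using edge_cases[OF r xy] child_of_parent[OF r in_arcsD2[OF xy]] by auto
    qed
    show "insert (parent G r x) (children G r x) \<subseteq> neighbors G x"
      using parent_edge[OF r x False] by (auto simp: children_def neighbors_def)
  qed
  moreover have "parent G r x \<notin> children G r x"
    using depth_parent[OF r x False] by (auto simp: children_def)
  ultimately show ?thesis using False finite_children by simp
qed

end

text \<open>
  Root both trees. A vertex of \<open>S\<close> has at most as many children as any vertex of
  \<open>T\<close> of the same depth, so children can be mapped injectively to children, generation
  by generation. Images of distinct vertices stay distinct because the parent of an image is the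
  image of the parent.
\<close>

lemma tree_embedding:
  fixes S :: "'a pair_pre_digraph" and T :: "'b pair_pre_digraph"
  assumes "infinite_tree S" and "infinite_tree T"
    and maxdeg: "\<And>x. x \<in> pverts S \<Longrightarrow> card (neighbors S x) \<le> D"
    and regular: "\<And>y. y \<in> pverts T \<Longrightarrow> card (neighbors T y) = D"
  obtains \<phi> where "inj_on \<phi> (pverts S)" "\<phi> ` pverts S \<subseteq> pverts T"
    and "\<And>x y. (x, y) \<in> parcs S \<Longrightarrow> (\<phi> x, \<phi> y) \<in> parcs T"
proof -
  interpret S: infinite_tree S by fact
  interpret T: infinite_tree T by fact
  obtain r where r: "r \<in> pverts S" using S.infinite_verts by fastforce
  obtain r' where r': "r' \<in> pverts T" using T.infinite_verts by fastforce
  \<comment> \<open>\<open>\<psi> x y\<close> places the children of \<open>x\<close> injectively below \<open>y\<close>, the chosen image of \<open>x\<close>.\<close>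
  define \<psi> where "\<psi> x y = (SOME f. f ` children S r x \<subseteq> children T r' y \<and> inj_on f (children S r x))"
    for x y
  define F where "F = rec_nat (\<lambda>_. r') (\<lambda>n f x. \<psi> (parent S r x) (f (parent S r x)) x)"
  define \<phi> where "\<phi> x = F (depth S r x) x" for x
  have root: "\<phi> r = r'" by (simp add: \<phi>_def F_def S.depth_root)
  have step: "\<phi> x = \<psi> (parent S r x) (\<phi> (parent S r x)) x" if "x \<in> pverts S" "x \<noteq> r" for x
    using S.depth_parent[OF r that] by (simp add: \<phi>_def F_def)
  have \<psi>: "\<psi> x y ` children S r x \<subseteq> children T r' y \<and> inj_on (\<psi> x y) (children S r x)"
    if "x \<in> pverts S" "y \<in> pverts T" "x = r \<longleftrightarrow> y = r'" for x y
  proof -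
    have "card (children S r x) \<le> card (children T r' y)"
      using S.card_children[OF r that(1)] T.card_children[OF r' that(2)] maxdeg[OF that(1)]
        regular[OF that(2)] that(3) by (auto split: if_splits)
    then have "\<exists>f. f ` children S r x \<subseteq> children T r' y \<and> inj_on f (children S r x)"
      using card_le_inj[OF S.finite_children T.finite_children] by simp
    from someI_ex[OF this] show ?thesis by (simp add: \<psi>_def)
  qed
  have good: "x \<in> pverts S \<Longrightarrow> \<phi> x \<in> pverts T \<and> depth T r' (\<phi> x) = depth S r x" for x
  proof (induction "depth S r x" arbitrary: x)
    case 0
    then show ?case using S.depth_eq_0_iff[OF r] root r' T.depth_root by auto
  next
    case (Suc n)
    have "x \<noteq> r" using Suc.hyps(2) S.depth_root by auto
    let ?p = "parent S r x"
    have p: "?p \<in> pverts S" "n = depth S r ?p"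
      using S.in_arcsD2[OF S.parent_edge[OF r Suc.prems \<open>x \<noteq> r\<close>]]
        S.depth_parent[OF r Suc.prems \<open>x \<noteq> r\<close>] Suc.hyps(2) by auto
    then have IH: "\<phi> ?p \<in> pverts T" "depth T r' (\<phi> ?p) = depth S r ?p"
      using Suc.hyps(1) by auto
    then have "?p = r \<longleftrightarrow> \<phi> ?p = r'"
      using S.depth_eq_0_iff[OF r p(1)] T.depth_eq_0_iff[OF r' IH(1)] by simp
    then have "\<phi> x \<in> children T r' (\<phi> ?p)"
      using \<psi>[OF p(1) IH(1)] S.child_of_parent[OF r Suc.prems \<open>x \<noteq> r\<close>]
        step[OF Suc.prems \<open>x \<noteq> r\<close>] by auto
    then show ?case
      using T.childD[OF r'] IH(2) p(2) Suc.hyps(2) by metis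
  qed
  have nonroot: "x = r \<longleftrightarrow> \<phi> x = r'" if "x \<in> pverts S" for x
    using S.depth_eq_0_iff[OF r that] T.depth_eq_0_iff[OF r'] good[OF that] by metis
  have child: "\<phi> x \<in> children T r' (\<phi> (parent S r x))" and
    \<psi>_inj: "inj_on (\<psi> (parent S r x) (\<phi> (parent S r x))) (children S r (parent S r x))"
    if x: "x \<in> pverts S" "x \<noteq> r" for x
  proof -
    have p: "parent S r x \<in> pverts S"
      using S.in_arcsD2[OF S.parent_edge[OF r x]] .
    have *: "\<psi> (parent S r x) (\<phi> (parent S r x)) ` children S r (parent S r x)
      \<subseteq> children T r' (\<phi> (parent S r x)) \<and>
      inj_on (\<psi> (parent S r x) (\<phi> (parent S r x))) (children S r (parent S r x))"
      using \<psi>[OF p _ nonroot[OF p]] good[OF p] by blast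
    then show "\<phi> x \<in> children T r' (\<phi> (parent S r x))"
      using S.child_of_parent[OF r x] step[OF x] by auto
    show "inj_on (\<psi> (parent S r x) (\<phi> (parent S r x))) (children S r (parent S r x))"
      using * by blast
  qed
  have "x = y" if "x \<in> pverts S" "y \<in> pverts S" "\<phi> x = \<phi> y" for x y
    using that
  proof (induction "depth S r x" arbitrary: x y)
    case 0
    then have "x = r" using S.depth_eq_0_iff[OF r] by auto
    then show ?case using nonroot 0 root by metis
  next
    case (Suc n)
    have x: "x \<noteq> r" using Suc.hyps(2) S.depth_root by auto
    then have y: "y \<noteq> r" using nonroot Suc.prems by metis
    let ?p = "parent S r x" and ?q = "parent S r y"
    have p: "?p \<in> pverts S" "n = depth S r ?p" and q: "?q \<in> pverts S"
      using S.in_arcsD2[OF S.parent_edge[OF r Suc.prems(1) x]]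
        S.in_arcsD2[OF S.parent_edge[OF r Suc.prems(2) y]]
        S.depth_parent[OF r Suc.prems(1) x] Suc.hyps(2) by auto
    have "\<phi> ?p = \<phi> ?q"
      using T.childD(3)[OF r' child[OF Suc.prems(1) x]]
        T.childD(3)[OF r' child[OF Suc.prems(2) y]] Suc.prems(3) by simp
    then have pq: "?p = ?q" using Suc.hyps(1)[OF p(2,1) q] by simp
    show ?case
      using \<psi>_inj[OF Suc.prems(1) x] step[OF Suc.prems(1) x] step[OF Suc.prems(2) y]
        Suc.prems(3) S.child_of_parent[OF r Suc.prems(1) x]
        S.child_of_parent[OF r Suc.prems(2) y] unfolding pq inj_on_def by metis
  qed
  then have "inj_on \<phi> (pverts S)" by (auto simp: inj_on_def)
  moreover have "\<phi> ` pverts S \<subseteq> pverts T" using good by auto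
  moreover have "(\<phi> x, \<phi> y) \<in> parcs T" if xy: "(x, y) \<in> parcs S" for x y
  proof -
    have "x \<noteq> r \<and> y = parent S r x \<or> y \<noteq> r \<and> x = parent S r y"
      using S.edge_cases[OF r xy] .
    then show ?thesis
    proof
      assume "x \<noteq> r \<and> y = parent S r x"
      then have "\<phi> x \<in> children T r' (\<phi> y)" using child[OF S.in_arcsD1[OF xy]] by auto
      then show ?thesis using T.sym_edges by (auto simp: children_def)
    next
      assume "y \<noteq> r \<and> x = parent S r y"
      then have "\<phi> y \<in> children T r' (\<phi> x)" using child[OF S.in_arcsD2[OF xy]] by auto
      then show ?thesis by (auto simp: children_def)
    qed
  qed
  ultimately show ?thesis using that by blast
qed

section \<open>Infection times and self-supporting sets\<close>

lemma initial_subset_final: "S \<subseteq> final_config G k S"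
  unfolding final_config_def using UN_upper[of 0 UNIV "\<lambda>t. (bootstrap_step G k ^^ t) S"] by simp

lemma step_iter_subset_verts:
  "S \<subseteq> pverts G \<Longrightarrow> (bootstrap_step G k ^^ t) S \<subseteq> pverts G"
  by (induction t) (auto simp: bootstrap_step_def)

lemma final_config_subset_verts: "S \<subseteq> pverts G \<Longrightarrow> final_config G k S \<subseteq> pverts G"
  unfolding final_config_def using step_iter_subset_verts by blast

definition infection_time :: "'a pair_pre_digraph \<Rightarrow> nat \<Rightarrow> 'a set \<Rightarrow> 'a \<Rightarrow> nat" where
  "infection_time G k S x = (LEAST t. x \<in> (bootstrap_step G k ^^ t) S)"

lemma infection_time_le: "x \<in> (bootstrap_step G k ^^ t) S \<Longrightarrow> infection_time G k S x \<le> t"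
  unfolding infection_time_def by (rule Least_le)

lemma infected_at_infection_time:
  assumes "x \<in> final_config G k S"
  shows "x \<in> (bootstrap_step G k ^^ infection_time G k S x) S"
  using assms unfolding infection_time_def final_config_def by (auto intro: LeastI_ex)

definition earlier_neighbors :: "'a pair_pre_digraph \<Rightarrow> nat \<Rightarrow> 'a set \<Rightarrow> 'a \<Rightarrow> 'a set" where
  "earlier_neighbors G k S x = {y \<in> neighbors G x \<inter> final_config G k S.
     infection_time G k S y < infection_time G k S x}"

text \<open>
  A set certifies its own infection if each of its vertices is initially occupied or has enough
  neighbors, inside the set, that were infected before it.
\<close>

definition self_supporting :: "'a pair_pre_digraph \<Rightarrow> nat \<Rightarrow> 'a set \<Rightarrow> 'a set \<Rightarrow> bool" where
  "self_supporting G k S D \<longleftrightarrow> D \<subseteq> final_config G k S \<and>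
     (\<forall>x \<in> D - S. k \<le> card (earlier_neighbors G k S x \<inter> D))"

text \<open>
  The finite connected sets containing \<open>v\<close>, built up one adjacent vertex at a time.
  This form yields both the closure under unions and the covering walks by induction.
\<close>

inductive grown_from :: "'a pair_pre_digraph \<Rightarrow> 'a \<Rightarrow> 'a set \<Rightarrow> bool" for G v where
  start: "grown_from G v {v}"
| grow: "grown_from G v D \<Longrightarrow> u \<in> D \<Longrightarrow> (u, x) \<in> parcs G \<Longrightarrow> grown_from G v (insert x D)"

lemma finite_grown: "grown_from G v D \<Longrightarrow> finite D"
  by (induction rule: grown_from.induct) auto

lemma grown_contains_start: "grown_from G v D \<Longrightarrow> v \<in> D"
  by (induction rule: grown_from.induct) auto

lemma grown_from_Un:
  assumes "grown_from G x D'" and "grown_from G v D" "u \<in> D" "(u, x) \<in> parcs G"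
  shows "grown_from G v (D \<union> D')"
  using assms(1)
proof (induction rule: grown_from.induct)
  case start
  then show ?case using grown_from.grow[OF assms(2-4)] by simp
next
  case (grow D' w y)
  then show ?case using grown_from.grow[of G v "D \<union> D'" w y] by auto
qed

lemma grown_from_UN:
  assumes "finite Y" and "Y \<subseteq> neighbors G x" and "\<And>y. y \<in> Y \<Longrightarrow> grown_from G y (D y)"
  shows "grown_from G x (insert x (\<Union>y\<in>Y. D y))"
  using assms
proof (induction Y)
  case empty
  then show ?case using grown_from.start by simp
next
  case (insert y Y)
  then have "grown_from G x (insert x (\<Union>y\<in>Y. D y) \<union> D y)"
    by (intro grown_from_Un[of G y _ x _ x]) (auto simp: neighbors_def)
  then show ?case by (simp add: Un_commute)
qed

definition walks_from :: "'a pair_pre_digraph \<Rightarrow> 'a \<Rightarrow> nat \<Rightarrow> 'a list set" where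
  "walks_from G v n = {l. length l = Suc n \<and> hd l = v \<and> successively (\<lambda>x y. (x, y) \<in> parcs G) l}"

context percolation_graph
begin

text \<open>
  When a vertex \<open>x\<close> adjacent to \<open>u\<close> joins the set, the walk makes an
  excursion \<open>u, x, u\<close>, which costs two steps. Covering walks are easy to count, unlike
  connected sets.
\<close>

lemma grown_from_walk:
  assumes "grown_from G v D"
  shows "\<exists>l \<in> walks_from G v (2 * (card D - 1)). set l = D"
  using assms
proof (induction rule: grown_from.induct)
  case start
  have "[v] \<in> walks_from G v 0" by (simp add: walks_from_def)
  then show ?case by force
next
  case (grow D u x)
  then obtain l where l: "l \<in> walks_from G v (2 * (card D - 1))" "set l = D" by auto
  show ?case
  proof (cases "x \<in> D")
    case True
    then show ?thesis using l by (auto simp: insert_absorb)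
  next
    case False
    obtain a b where ab: "l = a @ u # b" using \<open>u \<in> D\<close> l(2) split_list by metis
    let ?l = "a @ [u, x, u] @ b"
    have "card D > 0" using finite_grown[OF grow(1)] grow(2) by (auto simp: card_gt_0_iff)
    then have "2 * (card (insert x D) - 1) = Suc (Suc (2 * (card D - 1)))"
      using False finite_grown[OF grow(1)] by simp
    moreover have "?l \<in> walks_from G v (Suc (Suc (2 * (card D - 1))))"
      using l(1) grow(3) sym_edges[OF grow(3)] unfolding ab walks_from_def
      by (auto simp: successively_append_iff successively_Cons hd_append split: if_splits)
    moreover have "set ?l = insert x D" using l(2) ab by auto
    ultimately show ?thesis by metis
  qed
qed

lemma walks_from_Suc: "walks_from G v (Suc n) = (\<Union>w\<in>neighbors G v. (#) v ` walks_from G w n)"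
proof (intro equalityI subsetI)
  fix l assume l: "l \<in> walks_from G v (Suc n)"
  then obtain w l' where "l = v # w # l'"
    by (cases l; cases "tl l") (auto simp: walks_from_def)
  then show "l \<in> (\<Union>w\<in>neighbors G v. (#) v ` walks_from G w n)"
    using l by (auto simp: walks_from_def neighbors_def)
next
  fix l assume "l \<in> (\<Union>w\<in>neighbors G v. (#) v ` walks_from G w n)"
  then obtain w l' where "l = v # l'" "w \<in> neighbors G v" "l' \<in> walks_from G w n" by auto
  then show "l \<in> walks_from G v (Suc n)"
    by (auto simp: walks_from_def neighbors_def successively_Cons)
qed

lemma finite_walks_from: "finite (walks_from G v n)"
proof (induction n arbitrary: v)
  case 0
  have "walks_from G v 0 \<subseteq> {[v]}" by (auto simp: walks_from_def length_Suc_conv)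
  then show ?case using finite_subset by blast
qed (simp add: walks_from_Suc finite_neighbors)

lemma card_walks_from:
  assumes deg: "\<And>x. x \<in> pverts G \<Longrightarrow> card (neighbors G x) \<le> \<Delta>" and "v \<in> pverts G"
  shows "card (walks_from G v n) \<le> \<Delta> ^ n"
  using assms(2)
proof (induction n arbitrary: v)
  case 0
  have "walks_from G v 0 \<subseteq> {[v]}" by (auto simp: walks_from_def length_Suc_conv)
  then show ?case using card_mono[of "{[v]}"] by fastforce
next
  case (Suc n)
  have "card (walks_from G v (Suc n)) \<le> (\<Sum>w\<in>neighbors G v. card ((#) v ` walks_from G w n))"
    unfolding walks_from_Suc by (rule card_UN_le[OF finite_neighbors])
  also have "\<dots> \<le> (\<Sum>w\<in>neighbors G v. \<Delta> ^ n)"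
    using Suc.IH neighbors_subset card_image_le[OF finite_walks_from] le_trans
    by (intro sum_mono) blast
  also have "\<dots> \<le> \<Delta> * \<Delta> ^ n" using deg[OF Suc.prems] by simp
  finally show ?case by simp
qed

lemma self_supporting_UN:
  assumes "\<And>i. i \<in> I \<Longrightarrow> self_supporting G k S (D i)"
  shows "self_supporting G k S (\<Union>i\<in>I. D i)"
  unfolding self_supporting_def
proof (intro conjI ballI)
  show "(\<Union>i\<in>I. D i) \<subseteq> final_config G k S"
    using assms by (auto simp: self_supporting_def)
  fix x assume "x \<in> (\<Union>i\<in>I. D i) - S"
  then obtain i where i: "i \<in> I" "x \<in> D i - S" by auto
  have "k \<le> card (earlier_neighbors G k S x \<inter> D i)"
    using assms[OF i(1)] i(2) by (auto simp: self_supporting_def)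
  also have "\<dots> \<le> card (earlier_neighbors G k S x \<inter> (\<Union>i\<in>I. D i))"
    using i(1) finite_neighbors by (intro card_mono) (auto simp: earlier_neighbors_def)
  finally show "k \<le> card (earlier_neighbors G k S x \<inter> (\<Union>i\<in>I. D i))" .
qed

lemma card_earlier_neighbors:
  assumes x: "x \<in> final_config G k S" and "x \<notin> S"
  shows "k \<le> card (earlier_neighbors G k S x)"
proof -
  let ?t = "infection_time G k S x"
  have xt: "x \<in> (bootstrap_step G k ^^ ?t) S" using infected_at_infection_time[OF x] .
  then have "?t \<noteq> 0" using \<open>x \<notin> S\<close> by (metis funpow_0)
  then obtain n where n: "?t = Suc n" using not0_implies_Suc by blast
  let ?A = "(bootstrap_step G k ^^ n) S"
  have "x \<notin> ?A" using infection_time_le[of x n G k S] n by auto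
  moreover have "x \<in> bootstrap_step G k ?A" using xt n by simp
  ultimately have "k \<le> card {w. (x, w) \<in> parcs G \<and> w \<in> ?A}"
    by (auto simp: bootstrap_step_def)
  also have "\<dots> \<le> card (earlier_neighbors G k S x)"
  proof (rule card_mono)
    show "finite (earlier_neighbors G k S x)"
      using finite_neighbors by (simp add: earlier_neighbors_def)
    show "{w. (x, w) \<in> parcs G \<and> w \<in> ?A} \<subseteq> earlier_neighbors G k S x"
      using infection_time_le[of _ n G k S] n
      by (auto simp: earlier_neighbors_def neighbors_def final_config_def less_Suc_eq_le)
  qed
  finally show ?thesis .
qed

text \<open>
  Trace back why \<open>x\<close> got infected: join the supporting sets of all neighbors infected
  earlier. The recursion is well founded and its outcome finite because infection times decrease and
  degrees are finite.
\<close>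

lemma exists_supporting_set:
  assumes "x \<in> final_config G k S"
  shows "\<exists>D. grown_from G x D \<and> self_supporting G k S D"
  using assms
proof (induction "infection_time G k S x" arbitrary: x rule: less_induct)
  case less
  show ?case
  proof (cases "x \<in> S")
    case True
    then have "self_supporting G k S {x}"
      using less.prems by (simp add: self_supporting_def)
    then show ?thesis using grown_from.start[of G x] by (intro exI[of _ "{x}"] conjI)
  next
    case False
    let ?Y = "earlier_neighbors G k S x"
    have fin: "finite ?Y" and sub: "?Y \<subseteq> neighbors G x"
      using finite_neighbors by (auto simp: earlier_neighbors_def)
    have "\<exists>D. grown_from G y D \<and> self_supporting G k S D" if "y \<in> ?Y" for y
      using less.hyps[of y] that by (auto simp: earlier_neighbors_def)
    then obtain D where D: "\<And>y. y \<in> ?Y \<Longrightarrow> grown_from G y (D y)"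
        "\<And>y. y \<in> ?Y \<Longrightarrow> self_supporting G k S (D y)"
      by metis
    let ?U = "\<Union>y\<in>?Y. D y"
    have "grown_from G x (insert x ?U)" by (rule grown_from_UN[OF fin sub D(1)])
    moreover have "self_supporting G k S (insert x ?U)"
      unfolding self_supporting_def
    proof (intro conjI ballI)
      have U: "self_supporting G k S ?U" using D(2) by (rule self_supporting_UN)
      then show "insert x ?U \<subseteq> final_config G k S"
        using less.prems by (simp add: self_supporting_def)
      fix z assume z: "z \<in> insert x ?U - S"
      have *: "card (earlier_neighbors G k S z \<inter> B) \<le> card (earlier_neighbors G k S z \<inter> insert x ?U)"
        if "B \<subseteq> insert x ?U" for B
        using that finite_neighbors by (intro card_mono) (auto simp: earlier_neighbors_def)
      show "k \<le> card (earlier_neighbors G k S z \<inter> insert x ?U)"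
      proof (cases "z \<in> ?U")
        case True
        then have "k \<le> card (earlier_neighbors G k S z \<inter> ?U)"
          using U z unfolding self_supporting_def by blast
        then show ?thesis using *[of ?U] by (meson le_trans subset_insertI)
      next
        case False
        then have "z = x" using z by blast
        moreover have "?Y \<subseteq> ?U" using D(1) grown_contains_start by fast
        ultimately have "earlier_neighbors G k S z \<inter> insert x ?U = ?Y" by blast
        then show ?thesis using card_earlier_neighbors less.prems \<open>x \<notin> S\<close> by metis
      qed
    qed
    ultimately show ?thesis by blast
  qed
qed

text \<open>
  A finite supporting set cannot exhaust an infinite component, so some vertex \<open>x\<close> of
  the component is adjacent to the set but outside it; adding a supporting set of \<open>x\<close>
  enlarges it.
\<close>

lemma large_supporting_set:
  assumes v: "v \<in> final_config G k S"
    and inf: "infinite {w. (v, w) \<in> (edges_in G (final_config G k S))\<^sup>*}"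
  shows "\<exists>D. grown_from G v D \<and> self_supporting G k S D \<and> n \<le> card D"
proof (induction n)
  case 0
  then show ?case using exists_supporting_set[OF v] by auto
next
  case (Suc n)
  then obtain D where D: "grown_from G v D" "self_supporting G k S D" "n \<le> card D" by blast
  have "\<exists>u x. u \<in> D \<and> x \<notin> D \<and> (u, x) \<in> edges_in G (final_config G k S)"
  proof (rule ccontr)
    assume no: "\<not> ?thesis"
    have "w \<in> D" if "(v, w) \<in> (edges_in G (final_config G k S))\<^sup>*" for w
      using that grown_contains_start[OF D(1)] no by induct blast+
    then have "{w. (v, w) \<in> (edges_in G (final_config G k S))\<^sup>*} \<subseteq> D" by blast
    then show False using inf finite_grown[OF D(1)] finite_subset by blast
  qed
  then obtain u x where ux: "u \<in> D" "x \<notin> D" "(u, x) \<in> parcs G" "x \<in> final_config G k S" by blast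
  obtain D' where D': "grown_from G x D'" "self_supporting G k S D'"
    using exists_supporting_set[OF ux(4)] by blast
  have "grown_from G v (D \<union> D')" by (rule grown_from_Un[OF D'(1) D(1) ux(1,3)])
  moreover have "self_supporting G k S (D \<union> D')"
    using self_supporting_UN[of "{D, D'}" k S "\<lambda>D. D"] D(2) D'(2) by auto
  moreover have "card (insert x D) \<le> card (D \<union> D')"
    using grown_contains_start[OF D'(1)] finite_grown[OF D(1)] finite_grown[OF D'(1)]
    by (intro card_mono) auto
  then have "Suc n \<le> card (D \<union> D')" using D(3) ux(2) finite_grown[OF D(1)] by simp
  ultimately show ?case by blast
qed

end

context infinite_tree
begin

text \<open>
  Each vertex of \<open>D\<close> outside \<open>S\<close> contributes at least two edges inside
  \<open>D\<close>, those to neighbors infected earlier. No edge is counted twice, because infection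
  times orient it. A forest on \<open>D\<close> has at most \<open>card D\<close> edges, since an
  edge is determined by its lower endpoint. So at most half of \<open>D\<close> lies outside
  \<open>S\<close>.
\<close>

lemma self_supporting_half_initial:
  assumes "2 \<le> k" and D: "self_supporting G k S D" and "finite D"
  shows "card D \<le> 2 * card (D \<inter> S)"
proof -
  obtain r where r: "r \<in> pverts G" using infinite_verts by fastforce
  let ?t = "infection_time G k S"
  let ?Y = "\<lambda>x. earlier_neighbors G k S x \<inter> D"
  define lower where "lower = (\<lambda>(x, y). if x \<noteq> r \<and> y = parent G r x then x else y)"
  have lower: "lower (x, y) = x \<and> y = parent G r x \<or> lower (x, y) = y \<and> x = parent G r y"
    if "(x, y) \<in> (SIGMA x:D - S. ?Y x)" for x y
    using that edge_cases[OF r, of x y] by (auto simp: lower_def earlier_neighbors_def neighbors_def)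
  have earlier: "?t y < ?t x" if "(x, y) \<in> (SIGMA x:D - S. ?Y x)" for x y
    using that by (auto simp: earlier_neighbors_def)
  have "inj_on lower (SIGMA x:D - S. ?Y x)"
  proof (rule inj_onI)
    fix p q
    assume pq: "p \<in> (SIGMA x:D - S. ?Y x)" "q \<in> (SIGMA x:D - S. ?Y x)" and "lower p = lower q"
    obtain x y x' y' where p: "p = (x, y)" and q: "q = (x', y')" by (metis surj_pair)
    have eq: "lower (x, y) = lower (x', y')" using \<open>lower p = lower q\<close> unfolding p q .
    \<comment> \<open>Equal lower endpoints give equal edges; the infection times then fix the orientation.\<close>
    have "x = x' \<and> y = y'"
      using lower[OF pq(1)[unfolded p]] lower[OF pq(2)[unfolded q]]
        earlier[OF pq(1)[unfolded p]] earlier[OF pq(2)[unfolded q]] eq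
      by (metis less_asym)
    then show "p = q" unfolding p q by simp
  qed
  moreover have "lower ` (SIGMA x:D - S. ?Y x) \<subseteq> D"
    by (auto simp: lower_def)
  ultimately have "card (SIGMA x:D - S. ?Y x) \<le> card D"
    using card_inj_on_le \<open>finite D\<close> by blast
  moreover have "card (SIGMA x:D - S. ?Y x) = (\<Sum>x\<in>D - S. card (?Y x))"
    using \<open>finite D\<close> by (intro card_SigmaI) auto
  moreover have "(\<Sum>x\<in>D - S. 2) \<le> (\<Sum>x\<in>D - S. card (?Y x))"
    using D \<open>2 \<le> k\<close> by (intro sum_mono) (force simp: self_supporting_def)
  ultimately have "2 * card (D - S) \<le> card D" by simp
  moreover have "card D = card (D \<inter> S) + card (D - S)"
    using \<open>finite D\<close> card_Int_Diff by blast
  ultimately show ?thesis by linarith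
qed

text \<open>
  What is left of percolation is a purely static property of the initial configuration, of which
  there are only exponentially many instances for each \<open>m\<close>.
\<close>

lemma infinite_component_dense_walks:
  assumes "2 \<le> k" and S: "S \<subseteq> pverts G" and "has_infinite_component G (final_config G k S)"
  shows "\<exists>v\<in>pverts G. \<exists>\<^sub>\<infinity>m. \<exists>l \<in> walks_from G v (2 * (m - 1)).
           card (set l) = m \<and> m \<le> 2 * card (set l \<inter> S)"
proof -
  have F: "final_config G k S \<subseteq> pverts G" by (rule final_config_subset_verts[OF S])
  obtain v where v: "v \<in> final_config G k S"
      "infinite {w. (v, w) \<in> (edges_in G (final_config G k S))\<^sup>*}"
    using assms(3) unfolding has_infinite_component_iff[OF F] by blast
  have "\<exists>m\<ge>n. \<exists>l \<in> walks_from G v (2 * (m - 1)). card (set l) = m \<and> m \<le> 2 * card (set l \<inter> S)" for n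
  proof -
    obtain D where D: "grown_from G v D" "self_supporting G k S D" "n \<le> card D"
      using large_supporting_set[OF v] by blast
    then show ?thesis
      using grown_from_walk[OF D(1)] self_supporting_half_initial[OF \<open>2 \<le> k\<close> D(2) finite_grown[OF D(1)]]
      by metis
  qed
  then show ?thesis using v(1) F unfolding INFM_nat_le by blast
qed

end

section \<open>Infection along an embedding\<close>

text \<open>
  Infection spreads at least as well in the larger graph: an injective edge-preserving map sends
  distinct occupied neighbors to distinct occupied neighbors.
\<close>

lemma embedding_bootstrap_step:
  assumes "percolation_graph S" "percolation_graph T"
    and inj: "inj_on \<phi> (pverts S)" and verts: "\<phi> ` pverts S \<subseteq> pverts T"
    and edges: "\<And>x y. (x, y) \<in> parcs S \<Longrightarrow> (\<phi> x, \<phi> y) \<in> parcs T"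
    and AB: "\<phi> ` A \<subseteq> B"
  shows "\<phi> ` bootstrap_step S k A \<subseteq> bootstrap_step T k B"
proof
  interpret S: percolation_graph S by fact
  interpret T: percolation_graph T by fact
  fix z assume "z \<in> \<phi> ` bootstrap_step S k A"
  then obtain x where x: "x \<in> bootstrap_step S k A" "z = \<phi> x" by blast
  show "z \<in> bootstrap_step T k B"
  proof (cases "x \<in> A")
    case True
    then show ?thesis using AB x(2) by (auto simp: bootstrap_step_def)
  next
    case False
    let ?N = "{w. (x, w) \<in> parcs S \<and> w \<in> A}" and ?N' = "{w. (z, w) \<in> parcs T \<and> w \<in> B}"
    have xV: "x \<in> pverts S" using False x by (auto simp: bootstrap_step_def)
    have "k \<le> card ?N" using False x by (auto simp: bootstrap_step_def)
    also have "card ?N = card (\<phi> ` ?N)"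
      using S.in_arcsD2 by (intro card_image[symmetric] inj_on_subset[OF inj]) auto
    also have "\<dots> \<le> card ?N'"
    proof (rule card_mono)
      show "finite ?N'"
        using T.finite_neighbors[of z] by (rule finite_subset[rotated]) (auto simp: neighbors_def)
      show "\<phi> ` ?N \<subseteq> ?N'" using edges AB x(2) by auto
    qed
    finally show ?thesis using xV verts x(2) by (auto simp: bootstrap_step_def)
  qed
qed

lemma embedding_final_config:
  assumes "percolation_graph S" "percolation_graph T"
    and "inj_on \<phi> (pverts S)" "\<phi> ` pverts S \<subseteq> pverts T"
    and "\<And>x y. (x, y) \<in> parcs S \<Longrightarrow> (\<phi> x, \<phi> y) \<in> parcs T"
    and AB: "\<phi> ` A \<subseteq> B"
  shows "\<phi> ` final_config S k A \<subseteq> final_config T k B"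
proof -
  have "\<phi> ` (bootstrap_step S k ^^ t) A \<subseteq> (bootstrap_step T k ^^ t) B" for t
  proof (induction t)
    case (Suc t)
    then show ?case
      using embedding_bootstrap_step[OF assms(1-5) Suc.IH] by simp
  qed (use AB in simp)
  then show ?thesis unfolding final_config_def by blast
qed

lemma embedding_complete_imp_infinite_component:
  assumes "percolation_graph S" "percolation_graph T" and "infinite (pverts S)"
    and inj: "inj_on \<phi> (pverts S)" and verts: "\<phi> ` pverts S \<subseteq> pverts T"
    and edges: "\<And>x y. (x, y) \<in> parcs S \<Longrightarrow> (\<phi> x, \<phi> y) \<in> parcs T"
    and AB: "\<phi> ` A \<subseteq> B" and "B \<subseteq> pverts T"
    and complete: "final_config S k A = pverts S"
  shows "has_infinite_component T (final_config T k B)"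
proof -
  interpret S: percolation_graph S by fact
  interpret T: percolation_graph T by fact
  let ?F = "final_config T k B"
  have sub: "\<phi> ` pverts S \<subseteq> ?F"
    using embedding_final_config[OF assms(1,2) inj verts edges AB, of k] complete by simp
  obtain r where r: "r \<in> pverts S" using \<open>infinite (pverts S)\<close> by fastforce
  have reach: "(\<phi> r, \<phi> w) \<in> (edges_in T ?F)\<^sup>*" if "w \<in> pverts S" for w
    using S.all_reachable[OF r that]
  proof (induction rule: rtrancl_induct)
    case (step y z)
    then have "(\<phi> y, \<phi> z) \<in> edges_in T ?F"
      using edges sub S.in_arcsD1[of y z] S.in_arcsD2[of y z] by blast
    then show ?case using step.IH by (rule rtrancl_into_rtrancl[rotated])
  qed simp
  have "infinite (\<phi> ` pverts S)" using \<open>infinite (pverts S)\<close> inj finite_imageD by blast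
  moreover have "\<phi> ` pverts S \<subseteq> {w. (\<phi> r, w) \<in> (edges_in T ?F)\<^sup>*}" using reach by auto
  ultimately have "infinite {w. (\<phi> r, w) \<in> (edges_in T ?F)\<^sup>*}" using finite_subset by blast
  then show ?thesis
    using T.has_infinite_component_iff[OF final_config_subset_verts[OF \<open>B \<subseteq> pverts T\<close>]] r sub
    by blast
qed

section \<open>Measurability\<close>

lemma prob_space_initial_law: "prob_space (initial_law G p)"
  unfolding initial_law_def by (intro prob_space_PiM prob_space_measure_pmf)

lemma measurable_occupied: "Measurable.pred (initial_law G p) (\<lambda>\<omega>. x \<in> occupied G \<omega>)"
proof (cases "x \<in> pverts G")
  case True
  then have "(\<lambda>\<omega>. \<omega> x) \<in> measurable (initial_law G p) (measure_pmf (bernoulli_pmf p))"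
    unfolding initial_law_def by (rule measurable_component_singleton)
  then show ?thesis using True by (simp add: occupied_def)
qed (simp add: occupied_def)

lemma occupied_subset_verts: "occupied G \<omega> \<subseteq> pverts G"
  by (auto simp: occupied_def)

context percolation_graph
begin

text \<open>
  The cardinality condition says that all vertices of one of finitely many finite sets are occupied.
\<close>

lemma measurable_bootstrap_step:
  assumes "\<And>x. Measurable.pred M (\<lambda>\<omega>. x \<in> A \<omega>)"
  shows "Measurable.pred M (\<lambda>\<omega>. x \<in> bootstrap_step G k (A \<omega>))"
proof -
  have "k \<le> card {w. (x, w) \<in> parcs G \<and> w \<in> B} \<longleftrightarrow>
      (\<exists>F\<in>{F. F \<subseteq> neighbors G x \<and> k \<le> card F}. \<forall>w\<in>F. w \<in> B)" (is "?l \<longleftrightarrow> ?r") for B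
  proof
    assume ?l
    then show ?r by (intro bexI[of _ "{w. (x, w) \<in> parcs G \<and> w \<in> B}"]) (auto simp: neighbors_def)
  next
    assume ?r
    then obtain F where F: "F \<subseteq> neighbors G x" "k \<le> card F" "\<forall>w\<in>F. w \<in> B" by blast
    have "finite {w. (x, w) \<in> parcs G \<and> w \<in> B}"
      using finite_neighbors[of x] by (rule finite_subset[rotated]) (auto simp: neighbors_def)
    then have "card F \<le> card {w. (x, w) \<in> parcs G \<and> w \<in> B}"
      using F by (intro card_mono) (auto simp: neighbors_def)
    then show ?l using F(2) by simp
  qed
  then have "x \<in> bootstrap_step G k (A \<omega>) \<longleftrightarrow> x \<in> A \<omega> \<or> x \<in> pverts G \<and>
      (\<exists>F\<in>{F. F \<subseteq> neighbors G x \<and> k \<le> card F}. \<forall>w\<in>F. w \<in> A \<omega>)" for \<omega>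
    by (auto simp: bootstrap_step_def)
  moreover have "Measurable.pred M (\<lambda>\<omega>. x \<in> A \<omega> \<or> x \<in> pverts G \<and>
      (\<exists>F\<in>{F. F \<subseteq> neighbors G x \<and> k \<le> card F}. \<forall>w\<in>F. w \<in> A \<omega>))"
    using finite_subset[OF _ finite_neighbors]
    by (intro pred_intros_logic pred_intros_finite assms) (auto simp: finite_neighbors)
  ultimately show ?thesis by simp
qed

lemma measurable_final_config:
  "Measurable.pred (initial_law G p) (\<lambda>\<omega>. x \<in> final_config G k (occupied G \<omega>))"
proof -
  have "Measurable.pred (initial_law G p) (\<lambda>\<omega>. x \<in> (bootstrap_step G k ^^ t) (occupied G \<omega>))" for t x
    by (induction t arbitrary: x) (auto intro: measurable_occupied measurable_bootstrap_step)
  then show ?thesis unfolding final_config_def by simp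
qed

lemma measurable_reachable:
  assumes "\<And>x. Measurable.pred M (\<lambda>\<omega>. x \<in> A \<omega>)"
  shows "Measurable.pred M (\<lambda>\<omega>. (v, w) \<in> (edges_in G (A \<omega>))\<^sup>*)"
proof -
  have "Measurable.pred M (\<lambda>\<omega>. (v, w) \<in> (edges_in G (A \<omega>)) ^^ n)" for n w
  proof (induction n arbitrary: w)
    case (Suc n)
    have "(v, w) \<in> (edges_in G (A \<omega>)) ^^ Suc n \<longleftrightarrow>
        (\<exists>u\<in>neighbors G w. (v, u) \<in> (edges_in G (A \<omega>)) ^^ n \<and> u \<in> A \<omega> \<and> w \<in> A \<omega>)" for \<omega>
      using sym_edges by (auto simp: neighbors_def)
    moreover have "Measurable.pred M (\<lambda>\<omega>. \<exists>u\<in>neighbors G w.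
        (v, u) \<in> (edges_in G (A \<omega>)) ^^ n \<and> u \<in> A \<omega> \<and> w \<in> A \<omega>)"
      by (intro pred_intros_logic pred_intros_finite finite_neighbors assms Suc.IH)
    ultimately show ?case by simp
  qed simp
  then show ?thesis unfolding rtrancl_power by simp
qed

text \<open>
  A component is infinite if and only if no finite set of vertices covers it, and there are only
  countably many finite sets of vertices.
\<close>

lemma percolation_event_measurable:
  "percolation_event G k p \<in> sets (initial_law G p)"
proof -
  let ?F = "\<lambda>\<omega>. final_config G k (occupied G \<omega>)"
  let ?C = "\<lambda>v \<omega>. {w. (v, w) \<in> (edges_in G (?F \<omega>))\<^sup>*}"
  have F: "?F \<omega> \<subseteq> pverts G" for \<omega>
    by (rule final_config_subset_verts[OF occupied_subset_verts])
  have C: "?C v \<omega> \<subseteq> pverts G" if "v \<in> pverts G" for v \<omega>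
  proof
    fix w assume "w \<in> ?C v \<omega>"
    then have "(v, w) \<in> (edges_in G (?F \<omega>))\<^sup>*" by simp
    then show "w \<in> pverts G" using that F by induct auto
  qed
  have inf_iff: "infinite (?C v \<omega>) \<longleftrightarrow>
      (\<forall>E\<in>{E. finite E \<and> E \<subseteq> pverts G}. \<exists>w\<in>pverts G - E. (v, w) \<in> (edges_in G (?F \<omega>))\<^sup>*)"
    if "v \<in> pverts G" for v \<omega>
  proof
    assume inf: "infinite (?C v \<omega>)"
    show "\<forall>E\<in>{E. finite E \<and> E \<subseteq> pverts G}. \<exists>w\<in>pverts G - E. (v, w) \<in> (edges_in G (?F \<omega>))\<^sup>*"
    proof
      fix E assume "E \<in> {E. finite E \<and> E \<subseteq> pverts G}"
      then have "\<not> ?C v \<omega> \<subseteq> E" using inf finite_subset by blast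
      then show "\<exists>w\<in>pverts G - E. (v, w) \<in> (edges_in G (?F \<omega>))\<^sup>*" using C[OF that] by blast
    qed
  next
    assume *: "\<forall>E\<in>{E. finite E \<and> E \<subseteq> pverts G}. \<exists>w\<in>pverts G - E. (v, w) \<in> (edges_in G (?F \<omega>))\<^sup>*"
    show "infinite (?C v \<omega>)"
    proof
      assume "finite (?C v \<omega>)"
      then have "?C v \<omega> \<in> {E. finite E \<and> E \<subseteq> pverts G}" using C[OF that] by blast
      from bspec[OF * this] show False by blast
    qed
  qed
  have "has_infinite_component G (?F \<omega>) \<longleftrightarrow> (\<exists>v\<in>pverts G. v \<in> ?F \<omega> \<and>
      (\<forall>E\<in>{E. finite E \<and> E \<subseteq> pverts G}. \<exists>w\<in>pverts G - E. (v, w) \<in> (edges_in G (?F \<omega>))\<^sup>*))"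
    for \<omega>
  proof -
    have "has_infinite_component G (?F \<omega>) \<longleftrightarrow> (\<exists>v\<in>pverts G. v \<in> ?F \<omega> \<and> infinite (?C v \<omega>))"
      unfolding has_infinite_component_iff[OF F] using F[of \<omega>] by (meson subsetD)
    also have "\<dots> \<longleftrightarrow> (\<exists>v\<in>pverts G. v \<in> ?F \<omega> \<and>
      (\<forall>E\<in>{E. finite E \<and> E \<subseteq> pverts G}. \<exists>w\<in>pverts G - E. (v, w) \<in> (edges_in G (?F \<omega>))\<^sup>*))"
      by (intro bex_cong refl conj_cong inf_iff)
    finally show ?thesis .
  qed
  then have "percolation_event G k p = {\<omega> \<in> space (initial_law G p). \<exists>v\<in>pverts G. v \<in> ?F \<omega> \<and>
      (\<forall>E\<in>{E. finite E \<and> E \<subseteq> pverts G}. \<exists>w\<in>pverts G - E. (v, w) \<in> (edges_in G (?F \<omega>))\<^sup>*)}"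
    unfolding percolation_event_def by (simp only:)
  moreover have "Measurable.pred (initial_law G p) (\<lambda>\<omega>. \<exists>v\<in>pverts G. v \<in> ?F \<omega> \<and>
      (\<forall>E\<in>{E. finite E \<and> E \<subseteq> pverts G}. \<exists>w\<in>pverts G - E. (v, w) \<in> (edges_in G (?F \<omega>))\<^sup>*))"
    by (intro measurable_pred_countable pred_intros_logic measurable_final_config
        measurable_reachable countable_verts countable_Collect_finite_subset countable_Diff)
  ultimately show ?thesis by (simp add: pred_def)
qed

lemma complete_occupation_measurable:
  "complete_occupation G k p \<in> sets (initial_law G p)"
proof -
  have "complete_occupation G k p = {\<omega> \<in> space (initial_law G p).
      \<forall>x\<in>pverts G. x \<in> final_config G k (occupied G \<omega>)}"
    using equalityI[OF final_config_subset_verts[OF occupied_subset_verts[of G]]]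
    unfolding complete_occupation_def by (auto simp: subset_iff)
  moreover have "Measurable.pred (initial_law G p)
      (\<lambda>\<omega>. \<forall>x\<in>pverts G. x \<in> final_config G k (occupied G \<omega>))"
    by (intro measurable_pred_countable measurable_final_config countable_verts)
  ultimately show ?thesis by (simp add: pred_def)
qed

lemma complete_occupation_at_1: "measure (initial_law G 1) (complete_occupation G k 1) = 1"
proof -
  interpret prob_space "initial_law G 1" by (rule prob_space_initial_law)
  have "\<forall>b\<in>set_pmf (bernoulli_pmf 1). b"
  proof
    fix b :: bool assume "b \<in> set_pmf (bernoulli_pmf 1)"
    then show b by (cases b) (auto simp: set_pmf_iff)
  qed
  then have "AE b in measure_pmf (bernoulli_pmf 1). b" by (simp only: AE_measure_pmf_iff)
  then have "AE \<omega> in initial_law G 1. \<omega> v" if "v \<in> pverts G" for v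
    unfolding initial_law_def using that by (intro AE_PiM_component prob_space_measure_pmf)
  then have "AE \<omega> in initial_law G 1. \<forall>v\<in>pverts G. \<omega> v"
    by (simp add: AE_ball_countable[OF countable_verts])
  then have "AE \<omega> in initial_law G 1. \<omega> \<in> complete_occupation G k 1"
  proof (rule AE_mp[OF _ AE_I2], intro impI)
    fix \<omega> assume \<omega>: "\<omega> \<in> space (initial_law G 1)" "\<forall>v\<in>pverts G. \<omega> v"
    then have "occupied G \<omega> = pverts G" by (auto simp: occupied_def)
    then have "final_config G k (occupied G \<omega>) = pverts G"
      using initial_subset_final[of "pverts G" G k] final_config_subset_verts[of "pverts G" G k] by auto
    then show "\<omega> \<in> complete_occupation G k 1" using \<omega>(1) by (simp add: complete_occupation_def)
  qed
  then show ?thesis using prob_eq_1[OF complete_occupation_measurable] by blast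
qed

end

section \<open>Absence of percolation at small density\<close>

context percolation_graph
begin

lemma prob_all_occupied:
  assumes "Q \<subseteq> pverts G" "finite Q" "p \<in> {0..1}"
  shows "measure (initial_law G p) {\<omega> \<in> space (initial_law G p). Q \<subseteq> occupied G \<omega>} = p ^ card Q"
proof -
  interpret product_prob_space "\<lambda>_. measure_pmf (bernoulli_pmf p)" "pverts G"
    by unfold_locales
  have "{\<omega> \<in> space (initial_law G p). Q \<subseteq> occupied G \<omega>} =
      prod_emb (pverts G) (\<lambda>_. measure_pmf (bernoulli_pmf p)) Q (Pi\<^sub>E Q (\<lambda>_. {True}))"
    using assms(1)
    by (auto simp: initial_law_def space_PiM prod_emb_def occupied_def subset_iff fun_eq_iff restrict_def)
  then have "measure (initial_law G p) {\<omega> \<in> space (initial_law G p). Q \<subseteq> occupied G \<omega>} =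
      (\<Prod>i\<in>Q. measure (measure_pmf (bernoulli_pmf p)) {True})"
    using measure_PiM_emb[OF assms(1,2), of "\<lambda>_. {True}"] by (simp add: initial_law_def)
  then show ?thesis using assms(3) by (simp add: measure_pmf_single)
qed

definition dense_walk_event :: "real \<Rightarrow> 'a \<Rightarrow> nat \<Rightarrow> ('a \<Rightarrow> bool) set" where
  "dense_walk_event p v m = {\<omega> \<in> space (initial_law G p).
     \<exists>l\<in>walks_from G v (2 * (m - 1)). card (set l) = m \<and> m \<le> 2 * card (set l \<inter> occupied G \<omega>)}"

lemma walks_from_subset_verts:
  assumes "l \<in> walks_from G v n" "v \<in> pverts G"
  shows "set l \<subseteq> pverts G"
  using assms
proof (induction n arbitrary: v l)
  case 0
  then show ?case by (auto simp: walks_from_def length_Suc_conv)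
next
  case (Suc n)
  then obtain w l' where "l = v # l'" "w \<in> neighbors G v" "l' \<in> walks_from G w n"
    unfolding walks_from_Suc by blast
  then show ?case using Suc.IH[of l' w] Suc.prems(2) neighbors_subset by auto
qed

text \<open>
  Union bound over the at most \<open>\<Delta> ^ (2 * (m - 1))\<close> walks and, for each of them,
  the at most \<open>2 ^ m\<close> choices of occupied vertices. Each choice has at least
  \<open>m / 2\<close> vertices, which are all occupied with probability at most
  \<open>sqrt p ^ m\<close>.
\<close>

lemma
  assumes deg: "\<And>x. x \<in> pverts G \<Longrightarrow> card (neighbors G x) \<le> \<Delta>" and "1 \<le> \<Delta>"
    and v: "v \<in> pverts G" and p: "p \<in> {0..1}"
  shows dense_walk_event_measurable: "dense_walk_event p v m \<in> sets (initial_law G p)"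
    and prob_dense_walk_event:
      "measure (initial_law G p) (dense_walk_event p v m) \<le> (2 * (real \<Delta>)\<^sup>2 * sqrt p) ^ m"
proof -
  interpret prob_space "initial_law G p" by (rule prob_space_initial_law)
  let ?M = "initial_law G p"
  let ?W = "{l \<in> walks_from G v (2 * (m - 1)). card (set l) = m}"
  define I where "I = (SIGMA l:?W. {Q. Q \<subseteq> set l \<and> m \<le> 2 * card Q})"
  let ?E = "\<lambda>i. {\<omega> \<in> space ?M. snd i \<subseteq> occupied G \<omega>}"
  have finW: "finite ?W" using finite_walks_from by simp
  have finI: "finite I" unfolding I_def using finW by (intro finite_SigmaI) auto
  have Q: "snd i \<subseteq> pverts G" "finite (snd i)" "m \<le> 2 * card (snd i)" if "i \<in> I" for i
    using that walks_from_subset_verts[OF _ v] finite_subset by (force simp: I_def)+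
  have sets: "?E i \<in> sets ?M" if "i \<in> I" for i
  proof -
    have "Measurable.pred ?M (\<lambda>\<omega>. \<forall>x\<in>snd i. x \<in> occupied G \<omega>)"
      by (intro pred_intros_finite Q[OF that] measurable_occupied)
    then show ?thesis by (simp add: pred_def subset_iff Ball_def)
  qed
  have eq: "dense_walk_event p v m = (\<Union>i\<in>I. ?E i)"
  proof (intro equalityI subsetI)
    fix \<omega> assume "\<omega> \<in> dense_walk_event p v m"
    then obtain l where "\<omega> \<in> space ?M" "l \<in> ?W" "m \<le> 2 * card (set l \<inter> occupied G \<omega>)"
      by (auto simp: dense_walk_event_def)
    then have "(l, set l \<inter> occupied G \<omega>) \<in> I" "\<omega> \<in> ?E (l, set l \<inter> occupied G \<omega>)"
      by (auto simp: I_def)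
    then show "\<omega> \<in> (\<Union>i\<in>I. ?E i)" by blast
  next
    fix \<omega> assume "\<omega> \<in> (\<Union>i\<in>I. ?E i)"
    then obtain l Q where *: "\<omega> \<in> space ?M" "l \<in> ?W" "Q \<subseteq> set l" "m \<le> 2 * card Q" "Q \<subseteq> occupied G \<omega>"
      by (auto simp: I_def)
    have "card Q \<le> card (set l \<inter> occupied G \<omega>)" using * by (intro card_mono) auto
    then show "\<omega> \<in> dense_walk_event p v m" using * by (auto simp: dense_walk_event_def intro!: bexI[of _ l])
  qed
  show "dense_walk_event p v m \<in> sets ?M"
    unfolding eq using finI sets by (rule sets.finite_UN)
  have s: "0 \<le> sqrt p" "sqrt p \<le> 1" using p by auto
  have "measure ?M (dense_walk_event p v m) \<le> (\<Sum>i\<in>I. measure ?M (?E i))"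
    unfolding eq using finI sets by (intro finite_measure_subadditive_finite) auto
  also have "\<dots> \<le> (\<Sum>i\<in>I. sqrt p ^ m)"
  proof (rule sum_mono)
    fix i assume i: "i \<in> I"
    have "measure ?M (?E i) = p ^ card (snd i)" using prob_all_occupied[OF Q(1,2)[OF i] p] .
    also have "\<dots> = sqrt p ^ (2 * card (snd i))" using p by (simp add: power_mult)
    also have "\<dots> \<le> sqrt p ^ m" using s Q(3)[OF i] by (intro power_decreasing) auto
    finally show "measure ?M (?E i) \<le> sqrt p ^ m" .
  qed
  also have "\<dots> = card I * sqrt p ^ m" by simp
  also have "\<dots> \<le> ((real \<Delta>)\<^sup>2) ^ m * 2 ^ m * sqrt p ^ m"
  proof (rule mult_right_mono)
    have "card I = (\<Sum>l\<in>?W. card {Q. Q \<subseteq> set l \<and> m \<le> 2 * card Q})"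
      unfolding I_def using finW by (intro card_SigmaI) auto
    also have "\<dots> \<le> (\<Sum>l\<in>?W. 2 ^ m)"
    proof (rule sum_mono)
      fix l assume "l \<in> ?W"
      then have "card {Q. Q \<subseteq> set l \<and> m \<le> 2 * card Q} \<le> card (Pow (set l))"
        by (intro card_mono) auto
      then show "card {Q. Q \<subseteq> set l \<and> m \<le> 2 * card Q} \<le> 2 ^ m"
        using \<open>l \<in> ?W\<close> by (simp add: card_Pow)
    qed
    also have "\<dots> = card ?W * 2 ^ m" by simp
    also have "card ?W \<le> card (walks_from G v (2 * (m - 1)))"
      using finite_walks_from by (intro card_mono) auto
    also have "\<dots> \<le> \<Delta> ^ (2 * (m - 1))" using card_walks_from[OF deg v] by simp
    also have "\<dots> \<le> \<Delta> ^ (2 * m)" using \<open>1 \<le> \<Delta>\<close> by (intro power_increasing) auto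
    also have "\<dots> = (\<Delta>\<^sup>2) ^ m" by (simp add: power_mult)
    finally have "card I \<le> (\<Delta>\<^sup>2) ^ m * 2 ^ m" by simp
    then have "real (card I) \<le> real ((\<Delta>\<^sup>2) ^ m * 2 ^ m)" by (rule of_nat_mono)
    then show "real (card I) \<le> ((real \<Delta>)\<^sup>2) ^ m * 2 ^ m" by simp
  qed (use s in simp)
  also have "\<dots> = (2 * (real \<Delta>)\<^sup>2 * sqrt p) ^ m" by (simp add: power_mult_distrib)
  finally show "measure ?M (dense_walk_event p v m) \<le> (2 * (real \<Delta>)\<^sup>2 * sqrt p) ^ m" .
qed

end

text \<open>
  The probabilities of the dense-walk events at a fixed vertex decay geometrically, so almost surely
  only finitely many of them occur (Borel-Cantelli), for all of the countably many vertices at once.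
\<close>

lemma (in infinite_tree) no_percolation_at_small_density:
  assumes deg: "\<And>x. x \<in> pverts G \<Longrightarrow> card (neighbors G x) \<le> \<Delta>" and \<Delta>: "1 \<le> \<Delta>"
    and "2 \<le> k" and p: "p \<in> {0..1}" and small: "2 * (real \<Delta>)\<^sup>2 * sqrt p < 1"
  shows "measure (initial_law G p) (percolation_event G k p) = 0"
proof -
  interpret prob_space "initial_law G p" by (rule prob_space_initial_law)
  let ?M = "initial_law G p"
  have "AE \<omega> in ?M. \<forall>\<^sub>F m in sequentially. \<omega> \<in> space ?M - dense_walk_event p v m"
    if v: "v \<in> pverts G" for v
  proof (rule borel_cantelli_AE1)
    show "summable (\<lambda>m. measure ?M (dense_walk_event p v m))"
    proof (rule summable_comparison_test'[OF summable_geometric])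
      show "norm (2 * (real \<Delta>)\<^sup>2 * sqrt p) < 1" using small p by simp
      show "norm (measure ?M (dense_walk_event p v m)) \<le> (2 * (real \<Delta>)\<^sup>2 * sqrt p) ^ m" for m
        using prob_dense_walk_event[OF deg \<Delta> v p] by simp
    qed
  qed (use dense_walk_event_measurable[OF deg \<Delta> v p] in \<open>simp_all add: emeasure_eq_measure\<close>)
  then have "AE \<omega> in ?M. \<forall>v\<in>pverts G. \<forall>\<^sub>F m in sequentially. \<omega> \<in> space ?M - dense_walk_event p v m"
    by (simp add: AE_ball_countable[OF countable_verts])
  then have "AE \<omega> in ?M. \<omega> \<notin> percolation_event G k p"
  proof (rule AE_mp[OF _ AE_I2], intro impI notI)
    fix \<omega> assume \<omega>: "\<omega> \<in> space ?M" "\<omega> \<in> percolation_event G k p"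
      and none: "\<forall>v\<in>pverts G. \<forall>\<^sub>F m in sequentially. \<omega> \<in> space ?M - dense_walk_event p v m"
    obtain v where v: "v \<in> pverts G" and inf: "\<exists>\<^sub>\<infinity>m. \<omega> \<in> dense_walk_event p v m"
      using infinite_component_dense_walks[OF \<open>2 \<le> k\<close> occupied_subset_verts, of \<omega>] \<omega>
      by (auto simp: percolation_event_def dense_walk_event_def)
    have "\<forall>\<^sub>\<infinity>m. \<omega> \<notin> dense_walk_event p v m"
      using bspec[OF none v] by (auto simp: cofinite_eq_sequentially elim: eventually_mono)
    then show False using inf by (simp add: frequently_def)
  qed
  then show ?thesis using prob_eq_0[OF percolation_event_measurable] by blast
qed

section \<open>Critical densities\<close>

text \<open>
  Coupling: restricting a configuration on \<open>T\<close> to an embedded copy of \<open>S\<close>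
  gives a configuration on \<open>S\<close> with the right law. If that one fills \<open>S\<close>,
  the copy of \<open>S\<close> is an infinite connected set of eventually occupied vertices in
  \<open>T\<close>.
\<close>

lemma complete_occupation_imp_percolation:
  assumes S: "infinite_tree S" and T: "infinite_tree T"
    and "\<And>x. x \<in> pverts S \<Longrightarrow> card (neighbors S x) \<le> D"
    and "\<And>y. y \<in> pverts T \<Longrightarrow> card (neighbors T y) = D"
  shows "measure (initial_law S p) (complete_occupation S k p)
    \<le> measure (initial_law T p) (percolation_event T k p)"
proof -
  interpret S: infinite_tree S by fact
  interpret T: infinite_tree T by fact
  interpret prob_space "initial_law T p" by (rule prob_space_initial_law)
  obtain \<phi> where inj: "inj_on \<phi> (pverts S)" and verts: "\<phi> ` pverts S \<subseteq> pverts T"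
    and edges: "\<And>x y. (x, y) \<in> parcs S \<Longrightarrow> (\<phi> x, \<phi> y) \<in> parcs T"
    using tree_embedding[OF S T assms(3,4)] by blast
  define pull where "pull \<omega> = (\<lambda>x\<in>pverts S. \<omega> (\<phi> x))" for \<omega> :: "'b \<Rightarrow> bool"
  have law: "initial_law S p = distr (initial_law T p) (initial_law S p) pull"
    unfolding initial_law_def pull_def
    by (rule distr_PiM_reindex[symmetric, where M = "\<lambda>_. measure_pmf (bernoulli_pmf p)"])
      (use inj verts in \<open>auto intro: prob_space_measure_pmf\<close>)
  have pull: "pull \<in> measurable (initial_law T p) (initial_law S p)"
    unfolding initial_law_def pull_def
    using verts by (intro measurable_restrict measurable_component_singleton) auto
  have "measure (initial_law S p) (complete_occupation S k p) =
      measure (initial_law T p) (pull -` complete_occupation S k p \<inter> space (initial_law T p))"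
    by (subst law) (rule measure_distr[OF pull S.complete_occupation_measurable])
  also have "\<dots> \<le> measure (initial_law T p) (percolation_event T k p)"
  proof (rule finite_measure_mono[OF _ T.percolation_event_measurable], rule subsetI)
    fix \<omega> assume \<omega>: "\<omega> \<in> pull -` complete_occupation S k p \<inter> space (initial_law T p)"
    have "\<phi> ` occupied S (pull \<omega>) \<subseteq> occupied T \<omega>"
      using verts by (auto simp: occupied_def pull_def)
    then have "has_infinite_component T (final_config T k (occupied T \<omega>))"
      using embedding_complete_imp_infinite_component[OF S.percolation_graph_axioms
          T.percolation_graph_axioms S.infinite_verts inj verts edges _ occupied_subset_verts] \<omega>
      by (auto simp: complete_occupation_def)
    then show "\<omega> \<in> percolation_event T k p" using \<omega> by (simp add: percolation_event_def)
  qed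
  finally show ?thesis .
qed

theorem proposition1p5:
  fixes d k :: nat
    and T :: "'a pair_pre_digraph"
    and Td :: "'b pair_pre_digraph"
  assumes "1 \<le> d" and "2 \<le> k"
    and "infinite_tree Td" and "regular_graph Td (d + 1)"
    and "infinite_tree T" and "has_max_degree T (d + 1)"
  shows "p_crit T k \<ge> q_crit Td k \<and> q_crit Td k > 0"
proof -
  interpret Td: infinite_tree Td by fact
  interpret T: infinite_tree T by fact
  let ?P = "{p \<in> {0..1}. measure (initial_law T p) (complete_occupation T k p) > 0}"
  let ?Q = "{p \<in> {0..1}. measure (initial_law Td p) (percolation_event Td k p) > 0}"
  have degT: "card (neighbors T x) \<le> d + 1" if "x \<in> pverts T" for x
    using assms(6) that by (simp add: has_max_degree_def out_degree_eq_card_neighbors)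
  have degTd: "card (neighbors Td y) = d + 1" if "y \<in> pverts Td" for y
    using assms(4) that by (simp add: regular_graph_def out_degree_eq_card_neighbors)
  have "?P \<subseteq> ?Q"
    using complete_occupation_imp_percolation[OF assms(5,3) degT degTd]
    by (auto intro: less_le_trans)
  \<comment> \<open>The infimum of the empty set is unspecified, so both sets must be known to be nonempty.\<close>
  moreover have "1 \<in> ?P" using T.complete_occupation_at_1 by simp
  moreover have "bdd_below ?Q" by (rule bdd_belowI[of _ 0]) simp
  ultimately have "Inf ?Q \<le> Inf ?P" by (intro cInf_superset_mono) auto
  \<comment> \<open>This is where the union bound stops being summable: \<open>2 * (d + 1)\<^sup>2 * sqrt p = 1\<close>.\<close>
  moreover have "(1 / (2 * (real (d + 1))\<^sup>2))\<^sup>2 \<le> Inf ?Q"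
  proof (rule cInf_greatest)
    show "?Q \<noteq> {}" using \<open>?P \<subseteq> ?Q\<close> \<open>1 \<in> ?P\<close> by blast
    fix p assume "p \<in> ?Q"
    then have p: "p \<in> {0..1}" and pos: "measure (initial_law Td p) (percolation_event Td k p) > 0"
      by auto
    have "\<not> 2 * (real (d + 1))\<^sup>2 * sqrt p < 1"
      using Td.no_percolation_at_small_density[of "d + 1" k p] degTd \<open>2 \<le> k\<close> p pos by fastforce
    then have "1 / (2 * (real (d + 1))\<^sup>2) \<le> sqrt p" by (simp add: field_simps)
    then have "(1 / (2 * (real (d + 1))\<^sup>2))\<^sup>2 \<le> (sqrt p)\<^sup>2"
      by (rule power_mono) simp
    then show "(1 / (2 * (real (d + 1))\<^sup>2))\<^sup>2 \<le> p" using p by (simp del: of_nat_add)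
  qed
  moreover have "0 < (1 / (2 * (real (d + 1))\<^sup>2))\<^sup>2" by simp
  ultimately show ?thesis unfolding p_crit_def q_crit_def by (intro conjI; linarith)
qed

end
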